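(* For every $x\in\mathbb{C}\setminus\{0\}$ for which all terms below are defined (that is, $-x^3$ is not an integer power of $q^3$, and none of $x^4$, $qx^4$, $q^3x^4$ is an integer power of $q^4$), $$\begin{aligned} f_{1,2,3}(x^{-1}q^2,q^3;q) ={}& x^{-1}m(x^{-3}q^2,-x^{3};q^{3})(q)_{\infty} + x^{-2}m(x^{-3}q,-x^{3};q^{3})(q)_{\infty} \\ & + x^{-1}\frac{\Theta_{6,12}\Theta(x^{4};q^{4})}{\Theta(-x^{3};q^{3})} \left[ x^{-2} m(-x^{-4}q, x^{4}; q^{4})- m(-x^{-4}q^3, x^{4}; q^{4})\right] \\ & - \frac{\Theta_{3,12}\Theta(qx^{4};q^{4})}{\Theta(-x^{3};q^{3})} \left[ x^{-2} m(-x^{-4}q, q x^{4}; q^{4})- m(-x^{-4}q^3, qx^{4}; q^{4})\right]\\ & - q^3x^{2}\frac{\Theta_{-3,12}\Theta(q^3x^{4};q^{4})}{\Theta(-x^{3};q^{3})}\left[ x^{-2}m(-x^{-4}q, q^3 x^{4}; q^{4})- m(-x^{-4}q^3, q^3 x^{4}; q^{4})\right]. \end{aligned}$$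
   Context: Throughout, $q\in\mathbb{C}$ with $0<|q|<1$. $(x;q)_\infty=\prod_{i\ge0}(1-xq^i)$, $(q)_\infty=(q;q)_\infty$, $\Theta(x;q)=(x;q)_\infty(q/x;q)_\infty(q;q)_\infty=\sum_{n\in\mathbb{Z}}(-1)^nq^{\binom n2}x^n$ (and likewise with $q$ replaced by a power of $q$), and $\Theta_{a,m}=\Theta(q^a;q^m)$. Appell function: $$m(x,z;q)=\frac{1}{\Theta(z;q)}\sum_{r=-\infty}^{\infty}\frac{(-1)^rq^{\binom{r}{2}}z^r}{1-q^{r-1}xz}.$$ Hecke-type double-sum: with $\mathrm{sg}(r)=1$ if $r\ge0$, $-1$ if $r<0$, and $\mathrm{sg}(r,s)=\frac{\mathrm{sg}(r)+\mathrm{sg}(s)}{2}$, for positive integers $a,b,c$ with $b^2-ac>0$, $$f_{a,b,c}(x,y;q) = \sum_{r,s \in \mathbb{Z}} \mathrm{sg}(r,s) (-1)^{r+s} x^r y^s q^{a\binom{r}{2}+brs+c\binom{s}{2}}.$$ *)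

theory Defs
  imports "HOL-Analysis.Analysis"
begin

definition qpoch_inf :: "complex \<Rightarrow> complex \<Rightarrow> complex" where
  "qpoch_inf x q = (\<Prod>i. 1 - x * q ^ i)"

definition Theta :: "complex \<Rightarrow> complex \<Rightarrow> complex" where
  "Theta x q = qpoch_inf x q * qpoch_inf (q / x) q * qpoch_inf q q"

definition Theta_sub :: "int \<Rightarrow> int \<Rightarrow> complex \<Rightarrow> complex" where
  "Theta_sub a m q = Theta (q powi a) (q powi m)"

text \<open>The binomial coefficient \<open>r(r-1)/2\<close> for all integers \<open>r\<close>; the division is exact.\<close>

definition choose2 :: "int \<Rightarrow> int" where
  "choose2 r = r * (r - 1) div 2"

text \<open>
  The bilateral sums below are unordered sums. For \<open>0 < norm q < 1\<close> they converge absolutely: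
  in \<open>appell_m\<close> for \<open>z \<noteq> 0\<close> when no denominator vanishes, and in \<open>hecke_f\<close> for
  \<open>x \<noteq> 0\<close>, \<open>y \<noteq> 0\<close> and \<open>a, b, c > 0\<close>, since \<open>sg2\<close> restricts the sum to the two
  quadrants where \<open>r\<close> and \<open>s\<close> have the same sign.
\<close>

definition appell_m :: "complex \<Rightarrow> complex \<Rightarrow> complex \<Rightarrow> complex" where
  "appell_m x z q =
     1 / Theta z q *
     (\<Sum>\<^sub>\<infinity>r::int. (-1) powi r * q powi choose2 r * z powi r / (1 - q powi (r - 1) * x * z))"

definition sg :: "int \<Rightarrow> complex" where
  "sg r = (if r \<ge> 0 then 1 else -1)"

definition sg2 :: "int \<Rightarrow> int \<Rightarrow> complex" where
  "sg2 r s = (sg r + sg s) / 2"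

definition hecke_f :: "int \<Rightarrow> int \<Rightarrow> int \<Rightarrow> complex \<Rightarrow> complex \<Rightarrow> complex \<Rightarrow> complex" where
  "hecke_f a b c x y q =
     (\<Sum>\<^sub>\<infinity>(r, s)\<in>(UNIV :: (int \<times> int) set).
        sg2 r s * (-1) powi (r + s) * x powi r * y powi s *
        q powi (a * choose2 r + b * r * s + c * choose2 s))"

end

theory Submission
  imports Defs
begin

text \<open>
  Multiplying \<open>m(X, z; Q)\<close> by \<open>\<Theta>(z; Q)\<close> removes its theta denominator, and for each of the Appell
  functions in question \<open>X z\<close> is minus a power of \<open>q\<close>, so that what remains is a Laurent series in
  \<open>x\<close> whose denominators have the form \<open>1 + q^n\<close> (\<open>has_sum_appell\<close>). After multiplication by
  \<open>\<Theta>(-x^3; q^3)\<close> the claim is therefore an identity between Laurent series in \<open>x\<close>.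

  The left side becomes a triple sum over \<open>k\<close> (from the theta series) and \<open>r, s\<close> (from the
  Hecke-type sum). The quadratic form in its exponent is degenerate: with \<open>r = 3k - n\<close> and
  \<open>s = t - 2k\<close> the summand equals

    \<open>x^n (-1)^(n+t) q^(n(n-3)/2 - 2nt + 3t(t+1)/2) sg(3k - n, t - 2k) (-q^n)^k\<close>

  (\<open>product_term_on_line\<close>). For fixed \<open>n\<close> and \<open>t\<close> the index \<open>k\<close> thus runs through a geometric
  progression, which the sign factor cuts down to the oriented segment from \<open>\<lceil>n/3\<rceil>\<close> to
  \<open>\<lfloor>t/2\<rfloor>\<close>. Its sum is \<open>1 / (1 + q^n)\<close> times a difference of two boundary terms
  (\<open>has_sum_line\<close>), and summing these over \<open>t\<close> leaves theta series at powers of \<open>q\<close>, which the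
  Jacobi triple product turns into theta functions.

  The lower boundary \<open>\<lceil>n/3\<rceil>\<close> does not depend on \<open>t\<close> and gives \<open>\<Theta>(q^(3-2n); q^3)\<close>. This is zero if
  \<open>3\<close> divides \<open>n\<close> and \<open>(q)_\<infinity>\<close> up to a signed power of \<open>q\<close> otherwise; the two nonzero classes modulo
  \<open>3\<close> are the two Appell functions of base \<open>q^3\<close> (\<open>has_sum_lower_end\<close>). The upper boundary
  \<open>\<lfloor>t/2\<rfloor>\<close> depends on the parity of \<open>t\<close> and gives two theta functions of base \<open>q^12\<close>. By
  quasi-periodicity and reflection each of them is, up to a signed power of \<open>q\<close>, \<open>0\<close>,
  \<open>\<Theta>(q^3; q^12)\<close> or \<open>\<Theta>(q^6; q^12)\<close> according to \<open>n\<close> modulo \<open>4\<close>,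
  and the four classes produce the six Appell functions of base \<open>q^4\<close> (\<open>has_sum_upper_end\<close>).
\<close>

section \<open>Signed powers and triangular exponents\<close>

lemma neg_one_powi_eq: "even (a - b) \<Longrightarrow> (- 1 :: complex) powi a = (- 1) powi b"
  by (auto simp: power_int_minus_left)

text \<open>
  The coefficients that occur below are products of such monomials. With the two exponents kept
  apart, an equality of coefficients amounts to a parity statement and an integer identity
  between values of \<open>choose2\<close>, which is linear once \<open>choose2_double\<close> is applied.
\<close>

definition signed_power :: "complex \<Rightarrow> int \<Rightarrow> int \<Rightarrow> complex" where
  "signed_power q s e = (-1) powi s * q powi e"

lemma signed_power_mult:
  assumes "q \<noteq> 0"
  shows "signed_power q s e * signed_power q s' e' = signed_power q (s + s') (e + e')"
  using assms by (simp add: signed_power_def power_int_add)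

lemma signed_power_mult_assoc:
  assumes "q \<noteq> 0"
  shows "signed_power q s e * (signed_power q s' e' * c) = signed_power q (s + s') (e + e') * c"
  using signed_power_mult[OF assms] by (simp flip: mult.assoc)

lemma signed_power_cong:
  assumes "even (s - s')" "e = e'"
  shows "signed_power q s e = signed_power q s' e'"
  using neg_one_powi_eq[OF assms(1)] assms(2) by (simp add: signed_power_def)

lemma neg_powi_eq_signed_power: "(- (q powi n)) powi k = signed_power q k (n * k)"
proof -
  have "(- (q powi n)) powi k = ((- 1) * q powi n) powi k" by simp
  also have "\<dots> = signed_power q k (n * k)"
    unfolding power_int_mult_distrib signed_power_def by (simp add: power_int_mult)
  finally show ?thesis .
qed

lemma choose2_double: "2 * choose2 r = r * (r - 1)"
  by (simp add: choose2_def)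

lemma choose2_succ: "choose2 (r + 1) = choose2 r + r"
  using choose2_double[of r] choose2_double[of "r + 1"] by (simp add: algebra_simps)

lemma choose2_reflect: "choose2 (1 - r) = choose2 r"
  using choose2_double[of r] choose2_double[of "1 - r"] by (simp add: algebra_simps)

lemma choose2_add: "choose2 (a + b) = choose2 a + choose2 b + a * b"
  using choose2_double[of a] choose2_double[of b] choose2_double[of "a + b"]
  by (simp add: algebra_simps)

lemma has_sum_shift_int:
  fixes f :: "int \<Rightarrow> complex"
  shows "((\<lambda>k. f (k + a)) has_sum S) UNIV \<longleftrightarrow> (f has_sum S) UNIV"
  by (rule has_sum_reindex_bij_witness[of _ "\<lambda>k. k - a" "\<lambda>k. k + a"]) auto

section \<open>Theta series\<close>

definition theta_term :: "complex \<Rightarrow> complex \<Rightarrow> int \<Rightarrow> complex" where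
  "theta_term q z k = (-1) powi k * q powi choose2 k * z powi k"

lemma theta_term_succ:
  assumes "q \<noteq> 0" "z \<noteq> 0"
  shows "theta_term q z (k + 1) = - (z * q powi k) * theta_term q z k"
  using assms by (simp add: theta_term_def choose2_succ power_int_add)

lemma theta_term_reflect:
  assumes "q \<noteq> 0" "z \<noteq> 0"
  shows "theta_term q z (1 - k) = - z * theta_term q (1 / z) k"
  using assms
  by (simp add: theta_term_def choose2_reflect power_int_diff power_int_divide_distrib
      power_int_minus_left)

lemma summable_theta_term_nat:
  assumes "0 < norm q" "norm q < 1" "z \<noteq> 0"
  shows "summable (\<lambda>n. norm (theta_term q z (int n)))"
proof -
  have "(\<lambda>n. norm q ^ n * norm z) \<longlonglongrightarrow> 0 * norm z"
    by (intro tendsto_mult LIMSEQ_power_zero tendsto_const) (use assms in auto)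
  then have "eventually (\<lambda>n. norm q ^ n * norm z < 1/2) sequentially"
    by (rule order_tendstoD) auto
  then obtain N where N: "\<And>n. n \<ge> N \<Longrightarrow> norm q ^ n * norm z < 1/2"
    by (auto simp: eventually_sequentially)
  show ?thesis
  proof (rule summable_ratio_test[of "1/2" N])
    fix n assume "n \<ge> N"
    have "theta_term q z (int (Suc n)) = - (z * q ^ n) * theta_term q z (int n)"
      using theta_term_succ[of q z "int n"] assms by (simp add: add.commute)
    then have "norm (theta_term q z (int (Suc n))) =
        (norm q ^ n * norm z) * norm (theta_term q z (int n))"
      by (simp add: norm_mult norm_power)
    also have "\<dots> \<le> 1/2 * norm (theta_term q z (int n))"
      using N[OF \<open>n \<ge> N\<close>] by (intro mult_right_mono) auto
    finally show "norm (norm (theta_term q z (int (Suc n)))) \<le>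
        1/2 * norm (norm (theta_term q z (int n)))" by simp
  qed auto
qed

text \<open>
  The ratio of successive terms is \<open>-z q^k\<close>, which tends to zero as \<open>k\<close> grows; the reflection
  \<open>k \<mapsto> 1 - k\<close> carries the negative indices to the nonnegative ones, with \<open>1/z\<close> in place of \<open>z\<close>.
\<close>

lemma summable_on_theta_term:
  assumes "0 < norm q" "norm q < 1" "z \<noteq> 0"
  shows "theta_term q z summable_on A"
proof -
  have "(\<lambda>n. theta_term q z (int n)) summable_on UNIV" if "z \<noteq> 0" for z
    by (rule norm_summable_imp_summable_on, rule summable_theta_term_nat) (use assms that in auto)
  note nat = this
  have pos: "theta_term q z summable_on range int"
    by (subst summable_on_reindex) (use nat[OF assms(3)] in \<open>auto simp: o_def\<close>)
  have "(\<lambda>n. - z * theta_term q (1/z) (int n)) summable_on UNIV"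
    by (intro summable_on_cmult_right nat) (use assms in auto)
  then have neg: "theta_term q z summable_on range (\<lambda>n. 1 - int n)"
    by (subst summable_on_reindex)
       (use assms in \<open>auto simp: o_def theta_term_reflect inj_def\<close>)
  have "theta_term q z summable_on (range int \<union> (range (\<lambda>n. 1 - int n) - range int))"
    by (rule summable_on_Un_disjoint[OF pos summable_on_subset_banach[OF neg]]) auto
  moreover have "k \<in> range int \<union> (range (\<lambda>n. 1 - int n) - range int)" for k
  proof (cases "k \<ge> 0")
    case True
    then have "k = int (nat k)" by simp
    then show ?thesis by blast
  next
    case False
    then have "k = 1 - int (nat (1 - k))" by simp
    then show ?thesis by blast
  qed
  ultimately show ?thesis
    by (metis (full_types) summable_on_subset_banach subsetI)
qed

text \<open>
  Tannery's theorem, that is, dominated convergence for the counting measure on the integers.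
\<close>

lemma has_sum_dominated_limit:
  fixes f :: "nat \<Rightarrow> int \<Rightarrow> complex"
  assumes sums: "\<And>N. (f N has_sum S N) UNIV"
    and bound: "\<And>N k. norm (f N k) \<le> h k" and h: "h summable_on UNIV"
    and lim: "\<And>k. (\<lambda>N. f N k) \<longlonglongrightarrow> g k" and L: "S \<longlonglongrightarrow> L"
  shows "(g has_sum L) UNIV"
proof -
  have "integrable (count_space UNIV) h"
    using h summable_on_iff_abs_summable_on_real[of h UNIV] abs_summable_equivalent[of h UNIV]
    by (simp add: Infinite_Set_Sum.abs_summable_on_def)
  note dom = this
  have gb: "norm (g k) \<le> h k" for k
    by (rule Lim_norm_ubound[OF _ lim]) (use bound in auto)
  have gs: "(\<lambda>k. norm (g k)) summable_on UNIV"
    by (rule Infinite_Sum.abs_summable_on_comparison_test'[OF h]) (use gb in auto)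
  have fs: "(\<lambda>k. norm (f N k)) summable_on UNIV" for N
    by (rule Infinite_Sum.abs_summable_on_comparison_test'[OF h]) (use bound in auto)
  have "(\<lambda>N. infsetsum (f N) UNIV) \<longlonglongrightarrow> infsetsum g UNIV"
    unfolding infsetsum_def
    by (rule integral_dominated_convergence[OF _ _ dom]) (use lim bound in auto)
  also have "(\<lambda>N. infsetsum (f N) UNIV) = S"
    using fs infsumI[OF sums] by (simp add: infsetsum_infsum abs_summable_equivalent)
  also have "infsetsum g UNIV = infsum g UNIV"
    using gs by (simp add: infsetsum_infsum abs_summable_equivalent)
  finally have "infsum g UNIV = L"
    using L LIMSEQ_unique by blast
  then show ?thesis
    using gs abs_summable_summable has_sum_infsum by blast
qed

section \<open>The Jacobi triple product\<close>

lemma convergent_prod_qpoch: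
  assumes "norm q < 1"
  shows "convergent_prod (\<lambda>i. 1 - x * q ^ i :: complex)"
proof -
  have "summable (\<lambda>i. norm (1 - x * q ^ i - 1))"
    using assms by (simp add: norm_mult norm_power summable_mult summable_geometric)
  then show ?thesis
    using abs_convergent_prod_conv_summable abs_convergent_prod_imp_convergent_prod by blast
qed

lemma qpoch_tendsto:
  assumes "norm q < 1"
  shows "(\<lambda>n. \<Prod>i<n. 1 - x * q ^ i) \<longlonglongrightarrow> qpoch_inf x q"
proof -
  have "(\<lambda>n. \<Prod>i\<le>n. 1 - x * q ^ i) \<longlonglongrightarrow> qpoch_inf x q"
    unfolding qpoch_inf_def by (rule convergent_prod_LIMSEQ[OF convergent_prod_qpoch[OF assms]])
  then have "(\<lambda>n. \<Prod>i<Suc n. 1 - x * q ^ i) \<longlonglongrightarrow> qpoch_inf x q"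
    by (simp add: lessThan_Suc_atMost)
  then show ?thesis by (rule LIMSEQ_imp_Suc)
qed

lemma qpoch_inf_nonzero:
  assumes "norm q < 1" "\<And>i. x * q ^ i \<noteq> 1"
  shows "qpoch_inf x q \<noteq> 0"
  unfolding qpoch_inf_def
  by (rule prodinf_nonzero[OF convergent_prod_qpoch]) (metis assms right_minus_eq)+

lemma norm_lt_1_power_neq_1:
  assumes "norm (q :: complex) < 1"
  shows "q * q ^ i \<noteq> 1"
proof
  assume "q * q ^ i = 1"
  then have "norm q ^ Suc i = 1" by (metis norm_one norm_power power_Suc)
  moreover have "norm q ^ Suc i \<le> norm q ^ 1" by (rule power_decreasing) (use assms in auto)
  ultimately show False using assms by simp
qed

text \<open>
  A convergent infinite product vanishes only if one of its factors does, and the factors of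
  \<open>\<Theta>(z; q)\<close> vanish exactly at the powers of \<open>q\<close>.
\<close>

lemma Theta_nonzero:
  assumes "0 < norm q" "norm q < 1" "z \<noteq> 0" "\<And>k::int. z \<noteq> q powi k"
  shows "Theta z q \<noteq> 0"
proof -
  have "z * q ^ i \<noteq> 1" for i
  proof
    assume "z * q ^ i = 1"
    then have "z = q powi (- int i)" using assms by (simp add: power_int_minus field_simps)
    then show False using assms(4) by blast
  qed
  moreover have "q / z * q ^ i \<noteq> 1" for i
  proof
    assume "q / z * q ^ i = 1"
    then have "z = q powi (int (Suc i))" using assms unfolding power_int_of_nat by (simp add: field_simps)
    then show False using assms(4) by blast
  qed
  ultimately show ?thesis
    unfolding Theta_def using assms norm_lt_1_power_neq_1 qpoch_inf_nonzero by simp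
qed

text \<open>
  This is \<open>1 / (q; q)_m\<close>. The value \<open>0\<close> at negative \<open>m\<close> makes the recurrence \<open>recip_qfac_step\<close> valid
  for every integer \<open>m\<close>, so that no boundary cases arise in the induction below.
\<close>

definition recip_qfac :: "complex \<Rightarrow> int \<Rightarrow> complex" where
  "recip_qfac q m = (if m < 0 then 0 else 1 / (\<Prod>i<nat m. 1 - q * q ^ i))"

lemma recip_qfac_step:
  assumes "norm q < 1"
  shows "recip_qfac q m * (1 - q powi m) = recip_qfac q (m - 1)"
proof -
  consider "m < 0" | "m = 0" | n where "m = int (Suc n)"
    by (metis int_cases3 not0_implies_Suc of_nat_0_less_iff less_numeral_extra(3) neg_less_0_iff_less)
  then show ?thesis
  proof cases
    case 3
    have "nat m = Suc n" "nat (m - 1) = n" using 3 by auto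
    moreover have "q powi m = q * q ^ n" unfolding 3 power_int_of_nat by simp
    ultimately show ?thesis
      using 3 norm_lt_1_power_neq_1[OF assms] by (simp add: recip_qfac_def)
  qed (auto simp: recip_qfac_def)
qed

text \<open>
  Passing from \<open>N\<close> to \<open>N + 1\<close> multiplies the product by
  \<open>(1 - x q^N) (1 - q^(N+1) / x) = 1 + q^(2N+1) - x q^N - q^(N+1) / x\<close>, hence combines each
  coefficient with its two neighbours. By the ratio of successive theta terms the claim reduces to
  a three-term recurrence for the q-binomial coefficients \<open>(q; q)_2N / ((q; q)_(N-k) (q; q)_(N+k))\<close>.
\<close>

lemma finite_triple_product:
  assumes q: "0 < norm q" "norm q < 1" and x: "x \<noteq> 0"
  shows "((\<lambda>k. theta_term q x k *
            ((\<Prod>i<2 * N. 1 - q * q ^ i) * recip_qfac q (int N - k) * recip_qfac q (int N + k)))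
          has_sum (\<Prod>i<N. (1 - x * q ^ i) * (1 - q / x * q ^ i))) UNIV"
proof (induction N)
  case 0
  have "recip_qfac q (- k) * recip_qfac q k = 0" if "k \<noteq> 0" for k
    using that by (auto simp: recip_qfac_def)
  then show ?case
    by (intro has_sum_finite_neutralI[of "{0}"])
       (auto simp: theta_term_def recip_qfac_def choose2_def)
next
  case (Suc N)
  define c where
    "c k = (\<Prod>i<2 * N. 1 - q * q ^ i) * recip_qfac q (int N - k) * recip_qfac q (int N + k)" for k
  define P where "P = (\<Prod>i<N. (1 - x * q ^ i) * (1 - q / x * q ^ i))"
  let ?T = "theta_term q x"
  have q0: "q \<noteq> 0" using q by auto
  have IH: "((\<lambda>k. ?T k * c k) has_sum P) UNIV"
    using Suc unfolding c_def P_def .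
  have sum1: "((\<lambda>k. ?T k * ((1 + q ^ (2 * N + 1)) * c k)) has_sum ((1 + q ^ (2 * N + 1)) * P)) UNIV"
    using has_sum_cmult_right[OF IH, of "1 + q ^ (2 * N + 1)"] by (simp add: mult_ac)
  have "((\<lambda>k. - (x * q ^ N) * (?T (k - 1) * c (k - 1))) has_sum (- (x * q ^ N) * P)) UNIV"
    using has_sum_cmult_right[OF has_sum_shift_int[where a = "-1", THEN iffD2, OF IH], of "- (x * q ^ N)"]
    by simp
  moreover have "- (x * q ^ N) * (?T (k - 1) * c (k - 1)) =
      ?T k * (q powi (int N + 1 - k) * c (k - 1))" for k
  proof -
    have "q powi (int N + 1 - k) = q ^ N / q powi (k - 1)"
      using power_int_diff[of q "int N" "k - 1"] q0 by (simp add: algebra_simps)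
    moreover have "?T k = - (x * q powi (k - 1)) * ?T (k - 1)"
      using theta_term_succ[OF q0 x, of "k - 1"] by simp
    ultimately show ?thesis using q0 by simp
  qed
  ultimately have sum2:
    "((\<lambda>k. ?T k * (q powi (int N + 1 - k) * c (k - 1))) has_sum (- (x * q ^ N) * P)) UNIV"
    by simp
  have "((\<lambda>k. - (q ^ (N + 1) / x) * (?T (k + 1) * c (k + 1))) has_sum (- (q ^ (N + 1) / x) * P)) UNIV"
    using has_sum_cmult_right[OF has_sum_shift_int[where a = 1, THEN iffD2, OF IH],
        of "- (q ^ (N + 1) / x)"]
    by simp
  moreover have "- (q ^ (N + 1) / x) * (?T (k + 1) * c (k + 1)) =
      ?T k * (q powi (int N + 1 + k) * c (k + 1))" for k
    using theta_term_succ[OF q0 x, of k] q0 x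
    by (simp add: power_int_add field_simps)
  ultimately have sum3:
    "((\<lambda>k. ?T k * (q powi (int N + 1 + k) * c (k + 1))) has_sum (- (q ^ (N + 1) / x) * P)) UNIV"
    by simp
  have total: "((\<lambda>k. ?T k * ((1 + q ^ (2 * N + 1)) * c k) + ?T k * (q powi (int N + 1 - k) * c (k - 1))
          + ?T k * (q powi (int N + 1 + k) * c (k + 1)))
      has_sum ((1 + q ^ (2 * N + 1)) * P + - (x * q ^ N) * P + - (q ^ (N + 1) / x) * P)) UNIV"
    by (intro has_sum_add sum1 sum2 sum3)
  have prod_eq: "(1 + q ^ (2 * N + 1)) * P + - (x * q ^ N) * P + - (q ^ (N + 1) / x) * P =
      (\<Prod>i<Suc N. (1 - x * q ^ i) * (1 - q / x * q ^ i))"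
    unfolding prod.lessThan_Suc P_def[symmetric] using x by (simp add: field_simps power_add mult_2_right)
  have coeff: "(1 + q ^ (2 * N + 1)) * c k + q powi (int N + 1 - k) * c (k - 1)
      + q powi (int N + 1 + k) * c (k + 1) =
      (\<Prod>i<2 * Suc N. 1 - q * q ^ i) * recip_qfac q (int (Suc N) - k) * recip_qfac q (int (Suc N) + k)"
    for k
  proof -
    \<comment> \<open>In terms of \<open>a\<close>, \<open>b\<close> and the two reciprocal factorials of largest index, the recurrence is
        \<open>(1 - ab/q) (1 - ab) = (1 + ab/q) (1 - a) (1 - b) + a (1 - b) (1 - b/q) + b (1 - a) (1 - a/q)\<close>.\<close>
    define a b where "a = q powi (int N + 1 - k)" and "b = q powi (int N + 1 + k)"
    define U V where "U = recip_qfac q (int N + 1 - k)" and "V = recip_qfac q (int N + 1 + k)"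
    define M where "M = (\<Prod>i<2 * N. 1 - q * q ^ i)"
    have U1: "recip_qfac q (int N - k) = U * (1 - a)"
      unfolding U_def a_def recip_qfac_step[OF q(2)] by (simp add: algebra_simps)
    have V1: "recip_qfac q (int N + k) = V * (1 - b)"
      unfolding V_def b_def recip_qfac_step[OF q(2)] by (simp add: algebra_simps)
    have a': "q powi (int N - k) = a / q" and b': "q powi (int N + k) = b / q"
      using q0 by (simp_all add: a_def b_def power_int_add power_int_diff)
    have U2: "recip_qfac q (int N - (k + 1)) = U * (1 - a) * (1 - a / q)"
      using recip_qfac_step[OF q(2), of "int N - k"] unfolding U1 a' diff_diff_eq by simp
    have V2: "recip_qfac q (int N + (k - 1)) = V * (1 - b) * (1 - b / q)"
      using recip_qfac_step[OF q(2), of "int N + k"] unfolding V1 b' add_diff_eq by simp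
    have U0: "recip_qfac q (int N - (k - 1)) = U" "recip_qfac q (int (Suc N) - k) = U"
      and V0: "recip_qfac q (int N + (k + 1)) = V" "recip_qfac q (int (Suc N) + k) = V"
      by (simp_all add: U_def V_def algebra_simps)
    have ab: "q ^ (2 * N + 1) = a * b / q"
    proof -
      have "a * b = q powi (int (2 * N + 1) + 1)"
        unfolding a_def b_def using q0 by (subst power_int_add[symmetric]) (auto simp: algebra_simps)
      also have "\<dots> = q ^ (2 * N + 1) * q"
        using q0 by (subst power_int_add) (auto simp only: power_int_of_nat power_int_1_right)
      finally show ?thesis using q0 by simp
    qed
    have M': "(\<Prod>i<2 * Suc N. 1 - q * q ^ i) = M * (1 - a * b / q) * (1 - a * b)"
      using ab q0 by (simp add: M_def)
    show ?thesis
      unfolding c_def M' U0 V0 U1 V1 U2 V2 M_def[symmetric] ab a_def[symmetric] b_def[symmetric]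
      using q0 by (simp add: field_simps)
  qed
  show ?case
    using total unfolding prod_eq distrib_left[symmetric] coeff .
qed

text \<open>
  As \<open>N\<close> grows, the coefficients of the finite identity tend to \<open>1 / (q)_\<infinity>\<close>. They are bounded
  uniformly in \<open>N\<close> and \<open>k\<close>, so the theta series itself is a summable majorant.
\<close>

lemma jacobi_triple_product:
  assumes q: "0 < norm q" "norm q < 1" and x: "x \<noteq> 0"
  shows "(theta_term q x has_sum Theta x q) UNIV"
proof -
  let ?F = "\<lambda>n. \<Prod>i<n. 1 - q * q ^ i"
  have F: "?F \<longlonglongrightarrow> qpoch_inf q q" by (rule qpoch_tendsto[OF q(2)])
  have F0: "qpoch_inf q q \<noteq> 0"
    using qpoch_inf_nonzero[OF q(2)] norm_lt_1_power_neq_1[OF q(2)] by blast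
  have R: "(\<lambda>n. 1 / ?F n) \<longlonglongrightarrow> 1 / qpoch_inf q q"
    by (intro tendsto_divide F F0 tendsto_const)
  obtain B where B: "\<And>n. norm (?F n) \<le> B"
    using F convergent_imp_Bseq[of ?F] unfolding convergent_def Bseq_def by blast
  obtain C where C: "C > 0" "\<And>n. norm (1 / ?F n) \<le> C"
    using R convergent_imp_Bseq[of "\<lambda>n. 1 / ?F n"] unfolding convergent_def Bseq_def by blast
  have B0: "B \<ge> 0" using B[of 0] norm_ge_zero order_trans by blast
  have rC: "norm (recip_qfac q m) \<le> C" for m
    using C by (auto simp: recip_qfac_def intro: less_imp_le)
  have rlim: "(\<lambda>N. recip_qfac q (int N + k)) \<longlonglongrightarrow> 1 / qpoch_inf q q" for k
  proof -
    have "(\<lambda>N. 1 / ?F (nat (int N + k))) \<longlonglongrightarrow> 1 / qpoch_inf q q"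
    proof (rule filterlim_compose[OF R])
      show "filterlim (\<lambda>N. nat (int N + k)) sequentially sequentially"
        unfolding filterlim_at_top
      proof
        fix Z
        show "\<forall>\<^sub>F N in sequentially. Z \<le> nat (int N + k)"
          by (rule eventually_sequentiallyI[of "Z + nat (- k)"]) linarith
      qed
    qed
    moreover have "\<forall>\<^sub>F N in sequentially. 1 / ?F (nat (int N + k)) = recip_qfac q (int N + k)"
      by (rule eventually_sequentiallyI[of "nat (- k)"]) (auto simp: recip_qfac_def)
    ultimately show ?thesis by (rule Lim_transform_eventually)
  qed
  let ?f = "\<lambda>N k. theta_term q x k * (?F (2 * N) * recip_qfac q (int N - k) * recip_qfac q (int N + k))"
  have "((\<lambda>k. theta_term q x k * (1 / qpoch_inf q q)) has_sum
      (qpoch_inf x q * qpoch_inf (q / x) q)) UNIV"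
  proof (rule has_sum_dominated_limit)
    show "(?f N has_sum (\<Prod>i<N. (1 - x * q ^ i) * (1 - q / x * q ^ i))) UNIV" for N
      by (rule finite_triple_product[OF assms])
    show "norm (?f N k) \<le> norm (theta_term q x k) * (B * C * C)" for N k
      unfolding norm_mult by (intro mult_left_mono mult_mono B rC) (use B0 C in auto)
    show "(\<lambda>k. norm (theta_term q x k) * (B * C * C)) summable_on UNIV"
      using summable_on_theta_term[OF assms, of UNIV]
      by (intro summable_on_cmult_left) (simp add: summable_on_iff_abs_summable_on_complex)
    show "(\<lambda>N. ?f N k) \<longlonglongrightarrow> theta_term q x k * (1 / qpoch_inf q q)" for k
    proof -
      have "(\<lambda>N. ?F (2 * N)) \<longlonglongrightarrow> qpoch_inf q q"
        by (rule filterlim_compose[OF F])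
           (simp add: filterlim_subseq strict_mono_def)
      then have "(\<lambda>N. ?f N k) \<longlonglongrightarrow>
          theta_term q x k * (qpoch_inf q q * (1 / qpoch_inf q q) * (1 / qpoch_inf q q))"
        using rlim[of k] rlim[of "- k"] by (intro tendsto_mult tendsto_const) auto
      then show ?thesis using F0 by simp
    qed
    show "(\<lambda>N. \<Prod>i<N. (1 - x * q ^ i) * (1 - q / x * q ^ i)) \<longlonglongrightarrow>
        qpoch_inf x q * qpoch_inf (q / x) q"
      unfolding prod.distrib by (intro tendsto_mult qpoch_tendsto q)
  qed
  from has_sum_cmult_right[OF this, of "qpoch_inf q q"] show ?thesis
    using F0 by (simp add: Theta_def mult_ac)
qed

section \<open>Theta functions at powers of the base\<close>

text \<open>
  In the theta series, replacing \<open>z\<close> by \<open>q^m z\<close> shifts the summation index by \<open>m\<close>, up to a factor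
  that does not depend on the index.
\<close>

lemma Theta_shift:
  assumes q: "0 < norm q" "norm q < 1" and z: "z \<noteq> 0"
  shows "Theta (q powi m * z) q = (-1) powi m * q powi (- choose2 m) * z powi (- m) * Theta z q"
proof -
  have q0: "q \<noteq> 0" using q by auto
  let ?c = "(-1) powi m * q powi (- choose2 m) * z powi (- m)"
  have "theta_term q (q powi m * z) = (\<lambda>k. ?c * theta_term q z (k + m))"
  proof
    fix k
    have s: "(- 1 :: complex) powi m * (- 1) powi (k + m) = (- 1) powi k"
      by (subst power_int_add[symmetric]) (auto intro: neg_one_powi_eq)
    have e: "q powi (- choose2 m) * q powi choose2 (k + m) = q powi choose2 k * q powi (m * k)"
      using q0 by (simp add: choose2_add mult.commute flip: power_int_add)
    have p: "z powi (- m) * z powi (k + m) = z powi k"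
      using z by (simp flip: power_int_add)
    have "?c * theta_term q z (k + m) = ((- 1) powi m * (- 1) powi (k + m)) *
        (q powi (- choose2 m) * q powi choose2 (k + m)) * (z powi (- m) * z powi (k + m))"
      by (simp only: theta_term_def mult_ac)
    also have "\<dots> = theta_term q (q powi m * z) k"
      unfolding s e p using power_int_mult[of q m k]
      by (simp add: theta_term_def power_int_mult_distrib mult_ac)
    finally show "theta_term q (q powi m * z) k = ?c * theta_term q z (k + m)" ..
  qed
  moreover have "((\<lambda>k. ?c * theta_term q z (k + m)) has_sum (?c * Theta z q)) UNIV"
    by (intro has_sum_cmult_right has_sum_shift_int[THEN iffD2] jacobi_triple_product assms)
  moreover have "(theta_term q (q powi m * z) has_sum Theta (q powi m * z) q) UNIV"
    by (rule jacobi_triple_product) (use q z in auto)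
  ultimately show ?thesis
    using has_sum_unique by metis
qed

context
  fixes q :: complex and m :: int
  assumes q: "0 < norm q" "norm q < 1" and m: "m > 0"
begin

lemma base_powi: "0 < norm (q powi m)" "norm (q powi m) < 1"
proof -
  have m': "m = int (nat m)" using m by simp
  have "q powi m = q ^ nat m" using m by (metis m' power_int_of_nat)
  then show "0 < norm (q powi m)" "norm (q powi m) < 1"
    using q m by (auto simp: norm_power intro: power_less_one_iff[THEN iffD2])
qed

lemma has_sum_Theta_sub:
  "((\<lambda>k. signed_power q k (m * choose2 k + a * k)) has_sum Theta_sub a m q) UNIV"
proof -
  have "theta_term (q powi m) (q powi a) = (\<lambda>k. signed_power q k (m * choose2 k + a * k))"
    using q by (simp add: theta_term_def signed_power_def power_int_add power_int_mult fun_eq_iff)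
  then show ?thesis
    using jacobi_triple_product[OF base_powi, of "q powi a"] q by (simp add: Theta_sub_def)
qed

lemma Theta_sub_shift:
  "Theta_sub (a + m * j) m q = signed_power q j (- (m * choose2 j) - a * j) * Theta_sub a m q"
proof -
  have "q powi (a + m * j) = (q powi m) powi j * q powi a"
    using q by (simp add: power_int_add power_int_mult)
  moreover have "(q powi m) powi (- choose2 j) * (q powi a) powi (- j) = q powi (- (m * choose2 j) - a * j)"
    using power_int_add[of q "- (m * choose2 j)" "- (a * j)"] q by (simp flip: power_int_mult)
  ultimately show ?thesis
    using Theta_shift[OF base_powi, of "q powi a" j] q unfolding Theta_sub_def
    by (simp add: mult.assoc signed_power_def)
qed

lemma Theta_sub_reflect: "Theta_sub (m - a) m q = Theta_sub a m q"
  using q by (simp add: Theta_sub_def Theta_def power_int_diff mult_ac)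

text \<open>
  At the argument \<open>1\<close>, quasi-periodicity and the reflection \<open>z \<mapsto> q/z\<close> give \<open>\<Theta> = -\<Theta>\<close>; shifts carry the
  zero to all powers of the base.
\<close>

lemma Theta_sub_multiple: "Theta_sub (m * j) m q = 0"
proof -
  have "Theta_sub 0 m q = - Theta_sub 0 m q"
    using Theta_sub_shift[of 0 1] Theta_sub_reflect[of 0] by (simp add: choose2_def signed_power_def)
  then show ?thesis
    using Theta_sub_shift[of 0 j] by simp
qed

end

text \<open>
  The three factors of \<open>\<Theta>(q; q^3)\<close> collect the factors \<open>1 - q^i\<close> of \<open>(q)_\<infinity>\<close> by the residue of \<open>i\<close> modulo \<open>3\<close>.
\<close>

lemma Theta_sub_1_3:
  assumes q: "0 < norm q" "norm q < 1"
  shows "Theta_sub 1 3 q = qpoch_inf q q"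
proof -
  have q3: "norm (q ^ 3) < 1"
    using q by (simp add: norm_power power_less_one_iff)
  have fin: "(\<Prod>i<3 * n. 1 - q * q ^ i) =
      (\<Prod>i<n. 1 - q * (q ^ 3) ^ i) * (\<Prod>i<n. 1 - q ^ 2 * (q ^ 3) ^ i) * (\<Prod>i<n. 1 - q ^ 3 * (q ^ 3) ^ i)" for n
  proof (induction n)
    case (Suc n)
    have "3 * Suc n = Suc (Suc (Suc (3 * n)))" by simp
    moreover have "q * q ^ (3 * n) = q * (q ^ 3) ^ n" "q * q ^ Suc (3 * n) = q ^ 2 * (q ^ 3) ^ n"
      "q * q ^ Suc (Suc (3 * n)) = q ^ 3 * (q ^ 3) ^ n"
      by (simp_all add: power_mult power2_eq_square power3_eq_cube)
    ultimately show ?case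
      using Suc by (simp only: prod.lessThan_Suc) (simp add: mult_ac)
  qed simp
  have "(\<lambda>n. \<Prod>i<3 * n. 1 - q * q ^ i) \<longlonglongrightarrow> qpoch_inf q q"
    by (rule filterlim_compose[OF qpoch_tendsto[OF q(2)]]) (simp add: filterlim_subseq strict_mono_def)
  moreover have "(\<lambda>n. \<Prod>i<3 * n. 1 - q * q ^ i) \<longlonglongrightarrow>
      qpoch_inf q (q ^ 3) * qpoch_inf (q ^ 2) (q ^ 3) * qpoch_inf (q ^ 3) (q ^ 3)"
    unfolding fin by (intro tendsto_mult qpoch_tendsto q3)
  ultimately have "qpoch_inf q q = qpoch_inf q (q ^ 3) * qpoch_inf (q ^ 2) (q ^ 3) *
      qpoch_inf (q ^ 3) (q ^ 3)"
    by (rule LIMSEQ_unique)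
  moreover have "q ^ 3 / q = q ^ 2"
    using q by (simp add: power2_eq_square power3_eq_cube)
  ultimately show ?thesis
    by (simp add: Theta_sub_def Theta_def)
qed

section \<open>Bilateral and double sums\<close>

text \<open>
  The classes are written as \<open>m r - j\<close>, not \<open>m r + j\<close>, because most of the Appell series enter
  multiplied by a negative power \<open>x^(-j)\<close>; with this choice \<open>r\<close> is the summation index of those series.
\<close>

lemma has_sum_residue_classes:
  fixes f :: "int \<Rightarrow> complex" and m :: nat
  assumes m: "m > 0"
    and S: "\<And>j. j < m \<Longrightarrow> ((\<lambda>r. f (int m * r - int j)) has_sum S j) UNIV"
  shows "(f has_sum (\<Sum>j<m. S j)) UNIV"
proof -
  let ?B = "\<lambda>j. range (\<lambda>r. int m * r - int j)"
  have "(f has_sum (\<Sum>j<m. S j)) (\<Union>j\<in>{..<m}. ?B j)"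
  proof (rule sum_has_sum)
    show "(f has_sum S j) (?B j)" if "j \<in> {..<m}" for j
      using S[of j] that m by (subst has_sum_reindex) (auto simp: o_def inj_def)
    show "?B j \<inter> ?B k = {}" if "j \<in> {..<m}" "k \<in> {..<m}" "j \<noteq> k" for j k
    proof (rule ccontr)
      assume "?B j \<inter> ?B k \<noteq> {}"
      then obtain r s where "int m * r - int j = int m * s - int k" by blast
      then have "int j - int k = int m * (r - s)" by (simp add: algebra_simps)
      then have "int m dvd int j - int k" by simp
      moreover have "\<bar>int j - int k\<bar> < int m" using that by auto
      ultimately show False
        using that by (metis abs_of_nonneg dvd_imp_le_int eq_iff_diff_eq_0 linorder_not_le of_nat_0_le_iff of_nat_eq_iff)
    qed
  qed auto
  moreover have "n \<in> (\<Union>j\<in>{..<m}. ?B j)" for n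
  proof
    show "nat ((- n) mod int m) \<in> {..<m}" using m by (simp add: nat_less_iff)
    have "n = int m * (- ((- n) div int m)) - (- n) mod int m"
      using div_mult_mod_eq[of "- n" "int m"]
      unfolding mult_minus_right mult.commute[of "int m"] by linarith
    moreover have "int (nat ((- n) mod int m)) = (- n) mod int m" using m by simp
    ultimately have "n = int m * (- ((- n) div int m)) - int (nat ((- n) mod int m))" by argo
    then show "n \<in> ?B (nat ((- n) mod int m))" by (rule range_eqI)
  qed
  ultimately show ?thesis by (metis UNIV_eq_I)
qed

lemma has_sum_times:
  fixes f :: "'a \<Rightarrow> complex" and g :: "'b \<Rightarrow> complex"
  assumes f: "(f has_sum a) UNIV" and g: "(g has_sum b) UNIV"
  shows "((\<lambda>(i, j). f i * g j) has_sum (a * b)) UNIV"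
proof -
  have sf: "(\<lambda>i. norm (f i)) summable_on UNIV" and sg: "(\<lambda>j. norm (g j)) summable_on UNIV"
    using f g has_sum_imp_summable summable_on_iff_abs_summable_on_complex by blast+
  have "(\<lambda>p. norm (f (fst p)) * norm (g (snd p))) summable_on (SIGMA i:UNIV. UNIV)"
  proof (rule summable_on_SigmaI)
    show "((\<lambda>j. norm (f (fst (i, j))) * norm (g (snd (i, j)))) has_sum
        (norm (f i) * (\<Sum>\<^sub>\<infinity>j. norm (g j)))) UNIV" for i
      by (simp add: has_sum_cmult_right sg)
    show "(\<lambda>i. norm (f i) * (\<Sum>\<^sub>\<infinity>j. norm (g j))) summable_on UNIV"
      by (intro summable_on_cmult_left sf)
  qed simp
  then have "(\<lambda>(i, j). f i * g j) summable_on (SIGMA i:UNIV. UNIV)"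
    by (subst summable_on_iff_abs_summable_on_complex) (simp add: case_prod_unfold norm_mult)
  then have "((\<lambda>(i, j). f i * g j) has_sum (a * b)) (SIGMA i:UNIV. UNIV)"
    by (intro has_sum_SigmaI[where g = "\<lambda>i. f i * b"])
       (auto intro: has_sum_cmult_right has_sum_cmult_left f g)
  then show ?thesis by simp
qed

lemma sg2_cases: "sg2 r s = 0 \<or> norm (sg2 r s) = 1 \<and> r * s \<ge> 0"
  by (auto simp: sg2_def sg_def zero_le_mult_iff)

text \<open>
  On the support of the sign factor \<open>r s \<ge> 0\<close>, so the mixed factor \<open>q^(b r s)\<close> has norm at most \<open>1\<close> and
  the terms are dominated by a product of two theta series.
\<close>

lemma summable_hecke:
  assumes q: "0 < norm q" "norm q < 1" and abc: "a > 0" "b \<ge> 0" "c > 0" and xy: "x \<noteq> 0" "y \<noteq> 0"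
  shows "(\<lambda>(r, s). sg2 r s * (-1) powi (r + s) * x powi r * y powi s *
           q powi (a * choose2 r + b * r * s + c * choose2 s)) summable_on UNIV"
proof -
  have q0: "q \<noteq> 0" using q by auto
  have tx: "theta_term (q powi a) x summable_on UNIV" and ty: "theta_term (q powi c) y summable_on UNIV"
    by (intro summable_on_theta_term base_powi q abc xy)+
  have "(\<lambda>(r, s). theta_term (q powi a) x r * theta_term (q powi c) y s) summable_on UNIV"
    using has_sum_times[OF has_sum_infsum[OF tx] has_sum_infsum[OF ty]] has_sum_imp_summable by blast
  then have dom: "(\<lambda>p. norm (case p of (r, s) \<Rightarrow> theta_term (q powi a) x r *
      theta_term (q powi c) y s)) summable_on UNIV"
    by (simp add: summable_on_iff_abs_summable_on_complex)
  have "norm (case p of (r, s) \<Rightarrow> sg2 r s * (-1) powi (r + s) * x powi r * y powi s *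
           q powi (a * choose2 r + b * r * s + c * choose2 s))
      \<le> norm (case p of (r, s) \<Rightarrow> theta_term (q powi a) x r * theta_term (q powi c) y s)" for p
  proof -
    obtain r s where p: "p = (r, s)" by fastforce
    consider "sg2 r s = 0" | "norm (sg2 r s) = 1" "r * s \<ge> 0" using sg2_cases by blast
    then show ?thesis
    proof cases
      case 2
      have "norm (q powi (b * (r * s))) \<le> 1"
      proof -
        have "b * (r * s) = int (nat (b * (r * s)))" using 2 abc by simp
        then have "q powi (b * (r * s)) = q ^ nat (b * (r * s))" by (metis power_int_of_nat)
        then show ?thesis using q by (simp add: norm_power power_le_one)
      qed
      then have "norm (theta_term (q powi a) x r * theta_term (q powi c) y s) * norm (q powi (b * (r * s)))
          \<le> norm (theta_term (q powi a) x r * theta_term (q powi c) y s)"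
        by (rule mult_right_le_one_le[rotated -1]) auto
      moreover have "norm (sg2 r s * (-1) powi (r + s) * x powi r * y powi s *
           q powi (a * choose2 r + b * r * s + c * choose2 s)) =
        norm (theta_term (q powi a) x r * theta_term (q powi c) y s) * norm (q powi (b * (r * s)))"
        using 2 q0 by (simp add: theta_term_def norm_mult power_int_add norm_power_int mult_ac
            flip: power_int_mult)
      ultimately show ?thesis by (simp add: p)
    qed (simp add: p)
  qed
  then have "(\<lambda>p. norm (case p of (r, s) \<Rightarrow> sg2 r s * (-1) powi (r + s) * x powi r * y powi s *
           q powi (a * choose2 r + b * r * s + c * choose2 s))) summable_on UNIV"
    by (rule Infinite_Sum.abs_summable_on_comparison_test'[OF dom])
  then show ?thesis by (rule abs_summable_summable)
qed

lemma sum_powi_segment: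
  assumes "\<rho> \<noteq> 0" "\<rho> \<noteq> (1 :: complex)" "K \<le> M"
  shows "(\<Sum>k\<in>{K..<M}. \<rho> powi k) = (\<rho> powi K - \<rho> powi M) / (1 - \<rho>)"
  using assms(3)
proof (induction M rule: int_ge_induct)
  case (step M)
  have "{K..<M + 1} = insert M {K..<M}" using step by auto
  then have "(\<Sum>k\<in>{K..<M + 1}. \<rho> powi k) = \<rho> powi M + (\<rho> powi K - \<rho> powi M) / (1 - \<rho>)"
    using step by simp
  then show ?case
    using assms by (simp add: power_int_add field_simps)
qed simp

text \<open>
  The sign factor is \<open>1\<close> for \<open>K \<le> k < M\<close>, \<open>-1\<close> for \<open>M \<le> k < K\<close>, and \<open>0\<close> elsewhere. The sum is thus the
  oriented finite sum from \<open>K\<close> to \<open>M\<close>, given by one formula for both orders of \<open>K\<close> and \<open>M\<close>.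
\<close>

lemma has_sum_signed_geometric:
  assumes \<rho>: "\<rho> \<noteq> 0" "\<rho> \<noteq> 1"
  shows "((\<lambda>k. sg2 (k - K) (M - 1 - k) * \<rho> powi k) has_sum ((\<rho> powi K - \<rho> powi M) / (1 - \<rho>))) UNIV"
proof (cases "K \<le> M")
  case True
  show ?thesis
  proof (rule has_sum_finite_neutralI[of "{K..<M}"])
    show "(\<rho> powi K - \<rho> powi M) / (1 - \<rho>) =
        (\<Sum>k\<in>{K..<M}. sg2 (k - K) (M - 1 - k) * \<rho> powi k)"
      unfolding sum_powi_segment[OF \<rho> True, symmetric]
      by (intro sum.cong) (auto simp: sg2_def sg_def)
  qed (use True in \<open>auto simp: sg2_def sg_def\<close>)
next
  case False
  then have MK: "M \<le> K" by simp
  show ?thesis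
  proof (rule has_sum_finite_neutralI[of "{M..<K}"])
    have "(\<rho> powi K - \<rho> powi M) / (1 - \<rho>) = - (\<Sum>k\<in>{M..<K}. \<rho> powi k)"
      unfolding sum_powi_segment[OF \<rho> MK] by (simp add: minus_divide_left)
    also have "\<dots> = (\<Sum>k\<in>{M..<K}. sg2 (k - K) (M - 1 - k) * \<rho> powi k)"
      unfolding sum_negf[symmetric] by (intro sum.cong) (auto simp: sg2_def sg_def)
    finally show "(\<rho> powi K - \<rho> powi M) / (1 - \<rho>) =
        (\<Sum>k\<in>{M..<K}. sg2 (k - K) (M - 1 - k) * \<rho> powi k)" .
  qed (use False in \<open>auto simp: sg2_def sg_def\<close>)
qed

section \<open>Appell functions as Lambert series\<close>

text \<open>
  A bound that is uniform in \<open>n\<close> makes the theta series a majorant of every Lambert series with these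
  denominators.
\<close>

lemma norm_one_plus_powi:
  assumes q: "0 < norm q" "norm q < 1"
  shows "norm (1 + q powi n :: complex) \<ge> 1 - norm q"
proof (cases n rule: int_cases3)
  case (pos k)
  have "1 - norm q \<le> 1 - norm (q powi n)"
    using q pos power_decreasing[of 1 k "norm q"] by (simp add: norm_power)
  also have "\<dots> \<le> norm (1 + q powi n)"
    using norm_triangle_ineq2[of 1 "- (q powi n)"] by simp
  finally show ?thesis .
next
  case (neg k)
  have "norm q ^ k \<le> norm q"
    using q neg power_decreasing[of 1 k "norm q"] by simp
  then have "1 / norm q ^ k \<ge> 1 / norm q"
    using q by (intro divide_left_mono) auto
  \<comment> \<open>This is \<open>(1 - norm q)^2 \<ge> 0\<close> divided by \<open>norm q\<close>.\<close>
  moreover have "1 / norm q \<ge> 2 - norm q"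
  proof -
    have "(1 - norm q) ^ 2 \<ge> 0" by simp
    then have "1 \<ge> (2 - norm q) * norm q" by (simp add: power2_eq_square algebra_simps)
    then show ?thesis using q by (simp add: field_simps)
  qed
  moreover have "norm (q powi n) = 1 / norm q ^ k"
    using neg by (simp add: power_int_minus norm_inverse norm_power divide_inverse)
  moreover have "norm (q powi n) - 1 \<le> norm (1 + q powi n)"
    using norm_triangle_ineq2[of "q powi n" "- 1"] by (simp add: add.commute)
  ultimately show ?thesis by linarith
qed (use q in \<open>auto intro: order_trans[OF _ norm_ge_zero]\<close>)

lemma one_plus_powi_nonzero:
  assumes "0 < norm q" "norm q < 1"
  shows "1 + q powi n \<noteq> (0 :: complex)"
  using norm_one_plus_powi[OF assms, of n] assms by auto

text \<open>
  If \<open>X z = -q^d\<close>, the denominators of \<open>m(X, z; q^m)\<close> depend only on \<open>q\<close>, and a nonzero \<open>\<Theta>(z; q^m)\<close>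
  cancels the prefactor.
\<close>

lemma has_sum_appell:
  fixes m :: nat
  assumes q: "0 < norm q" "norm q < 1" and m: "m > 0" and z: "z \<noteq> 0"
    and Th: "Theta z (q ^ m) \<noteq> 0" and X: "X * z = - (q powi d)"
  shows "((\<lambda>r. (-1) powi r * q powi (int m * choose2 r) * z powi r / (1 + q powi (int m * (r - 1) + d)))
          has_sum (Theta z (q ^ m) * appell_m X z (q ^ m))) UNIV"
    (is "(?f has_sum _) UNIV")
proof -
  have q0: "q \<noteq> 0" using q by auto
  have qm: "0 < norm (q ^ m)" "norm (q ^ m) < 1"
    using q m by (auto simp: norm_power power_less_one_iff)
  have f: "?f r = theta_term (q ^ m) z r / (1 + q powi (int m * (r - 1) + d))" for r
    by (simp add: theta_term_def power_int_mult)
  have bound: "norm (?f r) \<le> norm (theta_term (q ^ m) z r) * (1 / (1 - norm q))" for r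
    unfolding f norm_divide divide_inverse[of "norm (theta_term _ _ _)"]
    using norm_one_plus_powi[OF q] q
    by (intro mult_left_mono) (auto simp: divide_inverse intro: le_imp_inverse_le)
  have dom: "(\<lambda>r. norm (theta_term (q ^ m) z r) * (1 / (1 - norm q))) summable_on UNIV"
    using summable_on_theta_term[OF qm z, of UNIV]
    by (intro summable_on_cmult_left) (simp add: summable_on_iff_abs_summable_on_complex)
  have "?f summable_on UNIV"
    by (rule abs_summable_summable, rule Infinite_Sum.abs_summable_on_comparison_test'[OF dom],
        rule bound)
  moreover have "?f r = (-1) powi r * (q ^ m) powi choose2 r *
      z powi r / (1 - (q ^ m) powi (r - 1) * X * z)" for r
  proof -
    have "(q ^ m) powi (r - 1) * X * z = - (q powi (int m * (r - 1)) * q powi d)"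
      by (simp add: mult.assoc X power_int_mult)
    also have "\<dots> = - (q powi (int m * (r - 1) + d))"
      using q0 by (simp add: power_int_add)
    finally show ?thesis by (simp add: power_int_mult)
  qed
  ultimately show ?thesis
    using Th by (simp add: appell_m_def)
qed

section \<open>The two boundary contributions\<close>

text \<open>
  The contributions of the lower boundary \<open>k = \<lceil>n/3\<rceil>\<close> and the upper boundary \<open>k = \<lfloor>t/2\<rfloor>\<close> to the
  coefficient of \<open>x^n\<close>, multiplied by \<open>1 + q^n\<close> and summed over \<open>t\<close>. The expression
  \<open>(n + 2) div 3\<close> is \<open>\<lceil>n/3\<rceil>\<close>. The first summand of \<open>upper_end\<close> comes from even \<open>t\<close>, the second
  from odd \<open>t\<close>.
\<close>

definition lower_end :: "complex \<Rightarrow> int \<Rightarrow> complex" where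
  "lower_end q n = (- (q powi n)) powi ((n + 2) div 3) *
     (signed_power q n (choose2 n - n) * Theta_sub (3 - 2 * n) 3 q)"

definition upper_end :: "complex \<Rightarrow> int \<Rightarrow> complex" where
  "upper_end q n = signed_power q n (choose2 n) * Theta_sub (9 - 3 * n) 12 q +
     signed_power q n (choose2 n + n) * Theta_sub (3 - 3 * n) 12 q"

context
  fixes q :: complex
  assumes q: "0 < norm q" "norm q < 1"
begin

private lemma q0: "q \<noteq> 0" using q by auto

text \<open>
  The conditions \<open>3k - n \<ge> 0\<close> and \<open>t - 2k \<ge> 0\<close> on the signs say \<open>k \<ge> \<lceil>n/3\<rceil>\<close> and \<open>k < \<lfloor>t/2\<rfloor> + 1\<close>. The
  ratio \<open>-q^n\<close> is never \<open>1\<close>.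
\<close>

lemma has_sum_line:
  "((\<lambda>k. sg2 (3 * k - n) (t - 2 * k) * (- (q powi n)) powi k) has_sum
     (((- (q powi n)) powi ((n + 2) div 3) - (- (q powi n)) powi (t div 2 + 1)) / (1 + q powi n))) UNIV"
proof -
  have "sg2 (3 * k - n) (t - 2 * k) = sg2 (k - (n + 2) div 3) (t div 2 + 1 - 1 - k)" for k
    unfolding sg2_def sg_def by (intro arg_cong2[of _ _ _ _ "\<lambda>a b. (a + b) / 2"] if_cong) presburger+
  moreover have "- (q powi n) \<noteq> 0" "- (q powi n) \<noteq> 1"
    using q0 one_plus_powi_nonzero[OF q, of n] by (auto simp: neg_eq_iff_add_eq_0 add.commute)
  ultimately show ?thesis
    using has_sum_signed_geometric[of "- (q powi n)" "(n + 2) div 3" "t div 2 + 1"] by simp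
qed

text \<open>
  The boundary \<open>\<lceil>n/3\<rceil>\<close> does not involve \<open>t\<close>, so only the signed power of \<open>q\<close> in front of the geometric sum
  has to be summed; it is a theta series of base \<open>q^3\<close>.
\<close>

lemma has_sum_lower_ends:
  "((\<lambda>t. signed_power q (n + t) (choose2 n - n - 2 * n * t + 3 * choose2 (t + 1))) has_sum
     (signed_power q n (choose2 n - n) * Theta_sub (3 - 2 * n) 3 q)) UNIV"
proof -
  have "signed_power q (n + t) (choose2 n - n - 2 * n * t + 3 * choose2 (t + 1)) =
      signed_power q n (choose2 n - n) * signed_power q t (3 * choose2 t + (3 - 2 * n) * t)" for t
    unfolding signed_power_mult[OF q0]
    using choose2_succ[of t] by (intro signed_power_cong) (simp_all add: algebra_simps)
  then show ?thesis
    using has_sum_cmult_right[OF has_sum_Theta_sub[OF q]] by simp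
qed

text \<open>
  The exponent \<open>\<lfloor>t/2\<rfloor> + 1\<close> is \<open>u + 1\<close> for \<open>t = 2u\<close> and \<open>u\<close> for \<open>t = 2u - 1\<close>. In each class \<open>6u^2\<close> is the
  quadratic part of the exponent of \<open>q\<close>, which is that of a theta series of base \<open>q^12\<close>.
\<close>

lemma has_sum_upper_ends:
  "((\<lambda>t. signed_power q (n + t) (choose2 n - n - 2 * n * t + 3 * choose2 (t + 1)) *
       (- (q powi n)) powi (t div 2 + 1)) has_sum (- upper_end q n)) UNIV"
    (is "(?f has_sum _) UNIV")
proof -
  let ?S = "\<lambda>j::nat. if j = 0 then - signed_power q n (choose2 n) * Theta_sub (9 - 3 * n) 12 q
     else - signed_power q n (choose2 n + n) * Theta_sub (3 - 3 * n) 12 q"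
  have even: "?f (2 * u) = - signed_power q n (choose2 n) *
      signed_power q u (12 * choose2 u + (9 - 3 * n) * u)" for u
  proof -
    have "?f (2 * u) = signed_power q (n + 2 * u) (choose2 n - n - 2 * n * (2 * u) +
        3 * choose2 (2 * u + 1)) *
        signed_power q (u + 1) (n * (u + 1))"
      by (simp add: neg_powi_eq_signed_power)
    also have "\<dots> = signed_power q 1 0 *
        (signed_power q n (choose2 n) * signed_power q u (12 * choose2 u + (9 - 3 * n) * u))"
      unfolding signed_power_mult[OF q0]
      using choose2_double[of u] choose2_double[of "2 * u + 1"]
      by (intro signed_power_cong) (simp_all add: algebra_simps)
    finally show ?thesis by (simp add: signed_power_def)
  qed
  have odd: "?f (2 * u - 1) = - signed_power q n (choose2 n + n) *
      signed_power q u (12 * choose2 u + (3 - 3 * n) * u)" for u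
  proof -
    have "(2 * u - 1) div 2 + 1 = u" by simp
    then have "?f (2 * u - 1) = signed_power q (n + (2 * u - 1)) (choose2 n - n -
        2 * n * (2 * u - 1) + 3 * choose2 (2 * u)) *
        signed_power q u (n * u)"
      by (simp add: neg_powi_eq_signed_power)
    also have "\<dots> = signed_power q 1 0 *
        (signed_power q n (choose2 n + n) * signed_power q u (12 * choose2 u + (3 - 3 * n) * u))"
      unfolding signed_power_mult[OF q0]
      using choose2_double[of u] choose2_double[of "2 * u"]
      by (intro signed_power_cong) (simp_all add: algebra_simps)
    finally show ?thesis by (simp add: signed_power_def)
  qed
  have "(?f has_sum (\<Sum>j<2. ?S j)) UNIV"
  proof (rule has_sum_residue_classes)
    fix j :: nat assume "j < 2"
    then consider "j = 0" | "j = 1" by linarith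
    then show "((\<lambda>r. ?f (int 2 * r - int j)) has_sum ?S j) UNIV"
    proof cases
      case 1
      have "((\<lambda>u. ?f (2 * u)) has_sum (- signed_power q n (choose2 n) * Theta_sub (9 - 3 * n) 12 q)) UNIV"
        unfolding even by (intro has_sum_cmult_right has_sum_Theta_sub[OF q]) simp
      then show ?thesis using 1 by simp
    next
      case 2
      have "((\<lambda>u. ?f (2 * u - 1)) has_sum (- signed_power q n (choose2 n + n) *
          Theta_sub (3 - 3 * n) 12 q)) UNIV"
        unfolding odd by (intro has_sum_cmult_right has_sum_Theta_sub[OF q]) simp
      then show ?thesis using 2 by simp
    qed
  qed simp
  moreover have "(\<Sum>j<2. ?S j) = - upper_end q n"
    by (simp add: upper_end_def lessThan_Suc numeral_2_eq_2)
  ultimately show ?thesis by metis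
qed

lemma Theta_sub_9_12: "Theta_sub 9 12 q = Theta_sub 3 12 q"
  using Theta_sub_reflect[OF q, of 12 3] by simp

text \<open>
  This is how the argument \<open>q^(-3)\<close> of the theorem enters: \<open>-3\<close> is \<open>9\<close> modulo \<open>12\<close>, and the
  reflection carries \<open>9\<close> to \<open>3\<close>.
\<close>

lemma Theta_sub_minus_3_12: "q ^ 3 * Theta_sub (-3) 12 q = - Theta_sub 3 12 q"
proof -
  have "q ^ 3 * Theta_sub (-3) 12 q = signed_power q 0 3 *
      (signed_power q (- 1) (- (12 * choose2 (- 1)) - 9 * (- 1)) * Theta_sub 9 12 q)"
    using Theta_sub_shift[OF q, of 12 9 "- 1"] by (simp add: signed_power_def)
  also have "\<dots> = - Theta_sub 9 12 q"
    unfolding signed_power_mult_assoc[OF q0] by (simp add: signed_power_def choose2_def)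
  finally show ?thesis by (simp add: Theta_sub_9_12)
qed

text \<open>
  For \<open>n = 3r - j\<close> with \<open>j\<close> in \<open>{0, 1, 2}\<close> the lower boundary is \<open>r\<close>, and \<open>3 - 2n\<close> is congruent to
  \<open>2j\<close> modulo \<open>3\<close>. The corresponding shift of the theta function leaves exactly the Gaussian factor
  of an Appell series of base \<open>q^3\<close>.
\<close>

lemma lower_end_3r: "lower_end q (3 * r) = 0"
  using Theta_sub_multiple[OF q, of 3 "1 - 2 * r"] by (simp add: lower_end_def algebra_simps)

lemma lower_end_3r_minus_1: "lower_end q (3 * r - 1) = q powi (3 * choose2 r) * qpoch_inf q q"
proof -
  have K: "(3 * r - 1 + 2) div 3 = r" by simp
  have "Theta_sub (3 - 2 * (3 * r - 1)) 3 q = Theta_sub (2 + 3 * (1 - 2 * r)) 3 q"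
    by (simp add: algebra_simps)
  also have "\<dots> = signed_power q (1 - 2 * r) (- (3 * choose2 (1 - 2 * r)) - 2 * (1 - 2 * r)) * qpoch_inf q q"
    using Theta_sub_shift[OF q, of 3 2 "1 - 2 * r"]
        Theta_sub_reflect[OF q, of 3 1] Theta_sub_1_3[OF q] by simp
  finally have "lower_end q (3 * r - 1) = signed_power q (r + (3 * r - 1 + (1 - 2 * r)))
     ((3 * r - 1) * r + (choose2 (3 * r - 1) - (3 * r - 1) +
         (- (3 * choose2 (1 - 2 * r)) - 2 * (1 - 2 * r)))) * qpoch_inf q q"
    unfolding lower_end_def K neg_powi_eq_signed_power by (simp only: signed_power_mult_assoc[OF q0])
  also have "\<dots> = signed_power q 0 (3 * choose2 r) * qpoch_inf q q"
    using choose2_double[of r] choose2_double[of "1 - 2 * r"] choose2_double[of "3 * r - 1"]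
    by (intro arg_cong2[of _ _ _ _ "(*)"] signed_power_cong) (simp_all add: algebra_simps)
  finally show ?thesis by (simp add: signed_power_def)
qed

lemma lower_end_3r_minus_2: "lower_end q (3 * r - 2) = q powi (3 * choose2 r) * qpoch_inf q q"
proof -
  have K: "(3 * r - 2 + 2) div 3 = r" by simp
  have "Theta_sub (3 - 2 * (3 * r - 2)) 3 q = Theta_sub (1 + 3 * (2 - 2 * r)) 3 q"
    by (simp add: algebra_simps)
  also have "\<dots> = signed_power q (2 - 2 * r) (- (3 * choose2 (2 - 2 * r)) - 1 * (2 - 2 * r)) * qpoch_inf q q"
    using Theta_sub_shift[OF q, of 3 1 "2 - 2 * r"] Theta_sub_1_3[OF q] by simp
  finally have "lower_end q (3 * r - 2) = signed_power q (r + (3 * r - 2 + (2 - 2 * r)))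
     ((3 * r - 2) * r + (choose2 (3 * r - 2) - (3 * r - 2) +
         (- (3 * choose2 (2 - 2 * r)) - 1 * (2 - 2 * r)))) * qpoch_inf q q"
    unfolding lower_end_def K neg_powi_eq_signed_power by (simp only: signed_power_mult_assoc[OF q0])
  also have "\<dots> = signed_power q 0 (3 * choose2 r) * qpoch_inf q q"
    using choose2_double[of r] choose2_double[of "2 - 2 * r"] choose2_double[of "3 * r - 2"]
    by (intro arg_cong2[of _ _ _ _ "(*)"] signed_power_cong) (simp_all add: algebra_simps)
  finally show ?thesis by (simp add: signed_power_def)
qed

text \<open>
  For \<open>n = 4r - j\<close> the theta arguments \<open>9 - 3n\<close> and \<open>3 - 3n\<close> are \<open>9 + 3j\<close> and \<open>3 + 3j\<close> modulo \<open>12\<close>. For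
  odd \<open>j\<close> one of them is \<open>0\<close>, so one term vanishes; for even \<open>j\<close> they are \<open>3\<close> and \<open>9\<close>, which the
  reflection identifies.
\<close>

lemma upper_end_4r:
  "upper_end q (4 * r) = signed_power q r (4 * choose2 r + r) * Theta_sub 3 12 q +
     signed_power q r (4 * choose2 r + 3 * r) * Theta_sub 3 12 q"
proof -
  have "upper_end q (4 * r) = signed_power q (4 * r) (choose2 (4 * r)) * Theta_sub (9 + 12 * (- r)) 12 q +
      signed_power q (4 * r) (choose2 (4 * r) + 4 * r) * Theta_sub (3 + 12 * (- r)) 12 q"
    by (simp add: upper_end_def)
  also have "\<dots> = signed_power q (4 * r + - r) (choose2 (4 * r) +
      (- (12 * choose2 (- r)) - 9 * (- r))) * Theta_sub 3 12 q +
      signed_power q (4 * r + - r) (choose2 (4 * r) + 4 * r + (- (12 * choose2 (- r)) - 3 * (- r))) *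
          Theta_sub 3 12 q"
    by (subst Theta_sub_shift[OF q], simp, subst Theta_sub_shift[OF q], simp)
        (simp only: signed_power_mult_assoc[OF q0] Theta_sub_9_12)
  also have "\<dots> = signed_power q r (4 * choose2 r + 3 * r) * Theta_sub 3 12 q +
      signed_power q r (4 * choose2 r + r) * Theta_sub 3 12 q"
    using choose2_double[of r] choose2_double[of "- r"] choose2_double[of "4 * r"]
    by (intro arg_cong2[where f = "\<lambda>a b. a * Theta_sub 3 12 q + b * Theta_sub 3 12 q"] signed_power_cong)
       (simp_all add: algebra_simps)
  finally show ?thesis by simp
qed

lemma upper_end_4r_minus_1:
  "upper_end q (4 * r - 1) = - (signed_power q r (4 * choose2 r) * Theta_sub 6 12 q)"
proof -
  have "upper_end q (4 * r - 1) = signed_power q (4 * r - 1) (choose2 (4 * r - 1)) *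
      Theta_sub (12 * (1 - r)) 12 q +
      signed_power q (4 * r - 1) (choose2 (4 * r - 1) + (4 * r - 1)) * Theta_sub (6 + 12 * (- r)) 12 q"
    by (simp add: upper_end_def algebra_simps)
  also have "\<dots> = signed_power q (4 * r - 1 + - r)
      (choose2 (4 * r - 1) + (4 * r - 1) + (- (12 * choose2 (- r)) - 6 * (- r))) * Theta_sub 6 12 q"
    by (subst Theta_sub_multiple[OF q], simp, subst Theta_sub_shift[OF q], simp)
        (simp only: signed_power_mult_assoc[OF q0] mult_zero_right add_0_left)
  also have "\<dots> = signed_power q (1 + r) (4 * choose2 r) * Theta_sub 6 12 q"
    using choose2_double[of r] choose2_double[of "- r"] choose2_double[of "4 * r - 1"]
    by (intro arg_cong2[of _ _ _ _ "(*)"] signed_power_cong)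
       (simp_all add: algebra_simps)
  finally show ?thesis by (simp add: signed_power_def power_int_add)
qed

text \<open>
  The second term is written with \<open>r - 1\<close> because it belongs to an Appell series that enters with the
  factor \<open>x^2\<close> rather than \<open>x^(-2)\<close>.
\<close>

lemma upper_end_4r_minus_2:
  "upper_end q (4 * r - 2) = - (signed_power q r (4 * choose2 r + r) * Theta_sub 3 12 q) -
     signed_power q (r - 1) (4 * choose2 (r - 1) + 3 * (r - 1)) * Theta_sub 3 12 q"
proof -
  have flip: "signed_power q (1 + s) e = - signed_power q s e" for s e
    by (simp add: signed_power_def power_int_add)
  have "upper_end q (4 * r - 2) = signed_power q (4 * r - 2) (choose2 (4 * r - 2)) *
      Theta_sub (3 + 12 * (1 - r)) 12 q +
      signed_power q (4 * r - 2) (choose2 (4 * r - 2) + (4 * r - 2)) * Theta_sub (9 + 12 * (- r)) 12 q"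
    by (simp add: upper_end_def algebra_simps)
  also have "\<dots> = signed_power q (4 * r - 2 + (1 - r)) (choose2 (4 * r - 2) +
      (- (12 * choose2 (1 - r)) - 3 * (1 - r))) * Theta_sub 3 12 q +
      signed_power q (4 * r - 2 + - r) (choose2 (4 * r - 2) + (4 * r - 2) +
          (- (12 * choose2 (- r)) - 9 * (- r))) * Theta_sub 3 12 q"
    by (subst Theta_sub_shift[OF q], simp, subst Theta_sub_shift[OF q], simp)
        (simp only: signed_power_mult_assoc[OF q0] Theta_sub_9_12)
  also have "\<dots> = signed_power q (1 + r) (4 * choose2 r + r) * Theta_sub 3 12 q +
      signed_power q (1 + (r - 1)) (4 * choose2 (r - 1) + 3 * (r - 1)) * Theta_sub 3 12 q"
    using choose2_double[of r] choose2_double[of "- r"] choose2_double[of "r - 1"]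
      choose2_double[of "1 - r"] choose2_double[of "4 * r - 2"]
    by (intro arg_cong2[where f = "\<lambda>a b. a * Theta_sub 3 12 q + b * Theta_sub 3 12 q"] signed_power_cong)
       (simp_all add: algebra_simps)
  finally show ?thesis unfolding flip by simp
qed

lemma upper_end_4r_minus_3:
  "upper_end q (4 * r - 3) = signed_power q r (4 * choose2 r) * Theta_sub 6 12 q"
proof -
  have "upper_end q (4 * r - 3) = signed_power q (4 * r - 3) (choose2 (4 * r - 3)) *
      Theta_sub (6 + 12 * (1 - r)) 12 q +
      signed_power q (4 * r - 3) (choose2 (4 * r - 3) + (4 * r - 3)) * Theta_sub (12 * (1 - r)) 12 q"
    by (simp add: upper_end_def algebra_simps)
  also have "\<dots> = signed_power q (4 * r - 3 + (1 - r))
      (choose2 (4 * r - 3) + (- (12 * choose2 (1 - r)) - 6 * (1 - r))) * Theta_sub 6 12 q"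
    by (subst Theta_sub_multiple[OF q], simp, subst Theta_sub_shift[OF q], simp)
        (simp only: signed_power_mult_assoc[OF q0] mult_zero_right add_0_right)
  also have "\<dots> = signed_power q r (4 * choose2 r) * Theta_sub 6 12 q"
    using choose2_double[of r] choose2_double[of "1 - r"] choose2_double[of "4 * r - 3"]
    by (intro arg_cong2[of _ _ _ _ "(*)"] signed_power_cong)
       (simp_all add: algebra_simps)
  finally show ?thesis .
qed

context
  fixes x :: complex
  assumes x: "x \<noteq> 0"
begin

section \<open>The product of the theta function and the Hecke-type sum\<close>

text \<open>
  The quadratic part of the exponent is half of \<open>3k^2 + (r + s) (r + 3s)\<close>. On the line \<open>r = 3k - n\<close>,
  \<open>s = t - 2k\<close> the coefficients of \<open>k^2\<close> cancel, and of the terms linear in \<open>k\<close> only \<open>n k\<close> survives.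
\<close>

lemma product_term_on_line:
  "theta_term (q ^ 3) (- (x ^ 3)) k *
     (sg2 (3 * k - n) (t - 2 * k) * (-1) powi ((3 * k - n) + (t - 2 * k)) *
      (x powi (-1) * q ^ 2) powi (3 * k - n) * (q ^ 3) powi (t - 2 * k) *
      q powi (1 * choose2 (3 * k - n) + 2 * (3 * k - n) * (t - 2 * k) + 3 * choose2 (t - 2 * k)))
   = x powi n * signed_power q (n + t) (choose2 n - n - 2 * n * t + 3 * choose2 (t + 1)) *
     (sg2 (3 * k - n) (t - 2 * k) * (- (q powi n)) powi k)"
proof -
  let ?r = "3 * k - n" and ?s = "t - 2 * k"
  have q3: "(q ^ 3) powi c = q powi (3 * c)" for c
    by (simp add: power_int_mult)
  have doubled: "(- 1 :: complex) powi (k + k) = (- 1) powi k * (- 1) powi k"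
    by (simp add: power_int_add)
  have "(- (x ^ 3)) powi k = (- 1) powi k * x powi (3 * k)"
    using power_int_mult_distrib[of "- 1" "x ^ 3" k] by (simp add: power_int_mult)
  then have 1: "theta_term (q ^ 3) (- (x ^ 3)) k = signed_power q (k + k) (3 * choose2 k) * x powi (3 * k)"
    unfolding theta_term_def signed_power_def q3 doubled by (simp only: mult_ac)
  have 2: "(x powi (-1) * q ^ 2) powi ?r = x powi (- ?r) * q powi (2 * ?r)"
  proof -
    have "(x powi (-1)) powi ?r = x powi (- ?r)"
      using power_int_mult[of x "- 1" ?r] by (simp only: mult_minus1)
    moreover have "(q ^ 2) powi c = q powi (2 * c)" for c
      by (simp add: power_int_mult)
    ultimately show ?thesis by (simp only: power_int_mult_distrib)
  qed
  have 4: "x powi (3 * k) * x powi (- ?r) = x powi n"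
    using x by (simp flip: power_int_add)
  have collect: "signed_power q a e * ((-1) powi b * (q powi e1 * (q powi e2 * q powi e3))) =
      signed_power q (a + b) (e + (e1 + (e2 + e3)))" for a b e e1 e2 e3
    using q0 by (simp add: signed_power_def power_int_add)
  have 5: "signed_power q (k + k) (3 * choose2 k) * ((-1) powi (?r + ?s) *
        (q powi (2 * ?r) * (q powi (3 * ?s) *
         q powi (1 * choose2 ?r + 2 * ?r * ?s + 3 * choose2 ?s)))) =
      signed_power q (k + k + (?r + ?s)) (3 * choose2 k +
          (2 * ?r + (3 * ?s + (1 * choose2 ?r + 2 * ?r * ?s + 3 * choose2 ?s))))"
    by (rule collect)
  have 6: "signed_power q (k + k + (?r + ?s)) (3 * choose2 k +
      (2 * ?r + (3 * ?s + (1 * choose2 ?r + 2 * ?r * ?s + 3 * choose2 ?s)))) =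
     signed_power q (n + t + k) (choose2 n - n - 2 * n * t + 3 * choose2 (t + 1) + n * k)"
  proof (rule signed_power_cong)
    show "3 * choose2 k + (2 * ?r + (3 * ?s + (1 * choose2 ?r + 2 * ?r * ?s + 3 * choose2 ?s))) =
        choose2 n - n - 2 * n * t + 3 * choose2 (t + 1) + n * k"
      using choose2_double[of k] choose2_double[of ?r] choose2_double[of ?s]
        choose2_double[of n] choose2_double[of "t + 1"]
      by (simp add: algebra_simps)
  qed simp
  have 7: "signed_power q (n + t + k) (choose2 n - n - 2 * n * t + 3 * choose2 (t + 1) + n * k) =
     signed_power q (n + t) (choose2 n - n - 2 * n * t + 3 * choose2 (t + 1)) * signed_power q k (n * k)"
    by (simp add: signed_power_mult[OF q0])
  have "theta_term (q ^ 3) (- (x ^ 3)) k *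
     (sg2 ?r ?s * (-1) powi (?r + ?s) * (x powi (-1) * q ^ 2) powi ?r * (q ^ 3) powi ?s *
      q powi (1 * choose2 ?r + 2 * ?r * ?s + 3 * choose2 ?s)) =
     sg2 ?r ?s * (x powi (3 * k) * x powi (- ?r)) *
     (signed_power q (k + k) (3 * choose2 k) * ((-1) powi (?r + ?s) *
        (q powi (2 * ?r) * (q powi (3 * ?s) *
         q powi (1 * choose2 ?r + 2 * ?r * ?s + 3 * choose2 ?s)))))"
    unfolding 1 2 q3 by (simp only: mult_ac)
  also have "\<dots> = x powi n * signed_power q (n + t) (choose2 n - n - 2 * n * t + 3 * choose2 (t + 1)) *
     (sg2 ?r ?s * (- (q powi n)) powi k)"
    unfolding 4 5 6 7 neg_powi_eq_signed_power by (simp only: mult_ac)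
  finally show ?thesis .
qed

text \<open>
  The triple sum converges absolutely as a product of absolutely convergent sums. The change of
  variables is a bijection of triples of integers, so the sum may be taken over \<open>k\<close>, then over
  \<open>t\<close>, then over \<open>n\<close>.
\<close>

lemma has_sum_Theta_times_hecke:
  "((\<lambda>n. x powi n * (lower_end q n + upper_end q n) / (1 + q powi n)) has_sum
     (Theta (- (x ^ 3)) (q ^ 3) * hecke_f 1 2 3 (x powi (-1) * q ^ 2) (q ^ 3) q)) UNIV"
    (is "(_ has_sum ?H) UNIV")
proof -
  let ?h = "\<lambda>(r, s). sg2 r s * (-1) powi (r + s) * (x powi (-1) * q ^ 2) powi r * (q ^ 3) powi s *
      q powi (1 * choose2 r + 2 * r * s + 3 * choose2 s)"
  let ?G = "\<lambda>n t. signed_power q (n + t) (choose2 n - n - 2 * n * t + 3 * choose2 (t + 1))"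
  let ?i = "\<lambda>((n, t), k). (k, (3 * k - n, t - 2 * k)) :: int \<times> int \<times> int"
  let ?j = "\<lambda>(k, (r, s)). ((3 * k - r, s + 2 * k), k) :: (int \<times> int) \<times> int"
  let ?K = "\<lambda>n. (- (q powi n)) powi ((n + 2) div 3)" and ?M = "\<lambda>n t. (- (q powi n)) powi (t div 2 + 1)"
  have q3: "0 < norm (q ^ 3)" "norm (q ^ 3) < 1"
    using q by (auto simp: norm_power power_less_one_iff)
  have "(?h has_sum hecke_f 1 2 3 (x powi (-1) * q ^ 2) (q ^ 3) q) UNIV"
    unfolding hecke_f_def by (rule has_sum_infsum, rule summable_hecke) (use q x in auto)
  from has_sum_times[OF jacobi_triple_product[OF q3] this, of "- (x ^ 3)"] x
  have "((\<lambda>(k, p). theta_term (q ^ 3) (- (x ^ 3)) k * ?h p) has_sum ?H) UNIV" by simp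
  also have "?this \<longleftrightarrow> ((\<lambda>((n, t), k). x powi n * ?G n t *
      (sg2 (3 * k - n) (t - 2 * k) * (- (q powi n)) powi k)) has_sum ?H) (UNIV \<times> UNIV)"
  proof (rule has_sum_reindex_bij_witness[of _ ?i ?j])
    show "?i (?j a) = a" for a by (simp add: case_prod_unfold)
    show "?j (?i b) = b" for b by (simp add: case_prod_unfold)
    show "(\<lambda>((n, t), k). x powi n * ?G n t * (sg2 (3 * k - n) (t - 2 * k) * (- (q powi n)) powi k)) (?j a) =
        (case a of (k, p) \<Rightarrow> theta_term (q ^ 3) (- (x ^ 3)) k * ?h p)" for a
    proof -
      obtain k r s where a: "a = (k, (r, s))" by (metis prod_cases3)
      show ?thesis
        unfolding a case_prod_conv product_term_on_line[symmetric] by simp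
    qed
  qed auto
  finally have "((\<lambda>(n, t). x powi n * ?G n t * ((?K n - ?M n t) / (1 + q powi n))) has_sum ?H) UNIV"
    by (rule has_sum_SigmaD) (use has_sum_cmult_right[OF has_sum_line] in auto)
  then have "((\<lambda>(n, t). x powi n * ?G n t * ((?K n - ?M n t) / (1 + q powi n))) has_sum ?H) (UNIV \<times> UNIV)"
    by simp
  then show ?thesis
  proof (rule has_sum_SigmaD)
    fix n
    have "((\<lambda>t. x powi n / (1 + q powi n) * (?K n * ?G n t + - (?G n t * ?M n t))) has_sum
        (x powi n / (1 + q powi n) * (lower_end q n + - (- upper_end q n)))) UNIV"
      unfolding lower_end_def
      by (intro has_sum_cmult_right has_sum_add has_sum_uminusI has_sum_lower_ends has_sum_upper_ends)
    then show "((\<lambda>t. case (n, t) of (n, t) \<Rightarrow> x powi n * ?G n t * ((?K n - ?M n t) / (1 + q powi n))) has_sum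
        (x powi n * (lower_end q n + upper_end q n) / (1 + q powi n))) UNIV"
      by (simp add: algebra_simps diff_divide_distrib)
  qed
qed

section \<open>Assembling the Appell functions\<close>

lemma has_sum_lower_end:
  assumes Th: "Theta (- (x ^ 3)) (q ^ 3) \<noteq> 0"
  shows "((\<lambda>n. x powi n * lower_end q n / (1 + q powi n)) has_sum
    (Theta (- (x ^ 3)) (q ^ 3) * qpoch_inf q q *
      (x powi (-1) * appell_m (x powi (-3) * q ^ 2) (- (x ^ 3)) (q ^ 3) +
       x powi (-2) * appell_m (x powi (-3) * q) (- (x ^ 3)) (q ^ 3)))) UNIV"
    (is "(?f has_sum _) UNIV")
proof -
  let ?A = "\<lambda>d. Theta (- (x ^ 3)) (q ^ 3) * appell_m (x powi (-3) * q ^ d) (- (x ^ 3)) (q ^ 3)"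
  let ?S = "\<lambda>j::nat. if j = 0 then 0 else if j = 1 then x powi (-1) * qpoch_inf q q * ?A 2
      else x powi (-2) * qpoch_inf q q * ?A 1"
  have A: "((\<lambda>r. q powi (3 * choose2 r) * x powi (3 * r) / (1 + q powi (3 * (r - 1) + int d))) has_sum
      ?A d) UNIV" for d
  proof -
    have "(-1) powi r * q powi (int 3 * choose2 r) * (- (x ^ 3)) powi r =
        q powi (3 * choose2 r) * x powi (3 * r)" for r
    proof -
      have "(- (x ^ 3)) powi r = (- 1) powi r * x powi (3 * r)"
        using power_int_mult_distrib[of "- 1" "x ^ 3" r] by (simp add: power_int_mult)
      then show ?thesis by simp
    qed
    note terms = this
    have X: "x powi (-3) * q ^ d * - (x ^ 3) = - (q powi int d)"
      using x by (simp add: power_int_minus)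
    show ?thesis
      using has_sum_appell[OF q _ _ Th X] x unfolding terms by simp
  qed
  have "(?f has_sum (\<Sum>j<3. ?S j)) UNIV"
  proof (rule has_sum_residue_classes)
    fix j :: nat assume "j < 3"
    then consider "j = 0" | "j = 1" | "j = 2" by linarith
    then show "((\<lambda>r. ?f (int 3 * r - int j)) has_sum ?S j) UNIV"
    proof cases
      case 1
      then show ?thesis by (simp add: lower_end_3r)
    next
      case 2
      have "?f (3 * r - 1) = x powi (-1) * qpoch_inf q q *
          (q powi (3 * choose2 r) * x powi (3 * r) / (1 + q powi (3 * (r - 1) + int 2)))" for r
        unfolding lower_end_3r_minus_1 using x
            by (simp add: power_int_diff power_int_minus divide_inverse mult_ac)
      then show ?thesis
        using has_sum_cmult_right[OF A[of 2], of "x powi (-1) * qpoch_inf q q"] one_plus_powi_nonzero[OF q] 2 by simp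
    next
      case 3
      have "?f (3 * r - 2) = x powi (-2) * qpoch_inf q q *
          (q powi (3 * choose2 r) * x powi (3 * r) / (1 + q powi (3 * (r - 1) + int 1)))" for r
        unfolding lower_end_3r_minus_2 using x
            by (simp add: power_int_diff power_int_minus divide_inverse mult_ac)
      then show ?thesis
        using has_sum_cmult_right[OF A[of 1], of "x powi (-2) * qpoch_inf q q"] one_plus_powi_nonzero[OF q] 3 by simp
    qed
  qed simp
  then show ?thesis by (simp add: numeral_3_eq_3 lessThan_Suc algebra_simps)
qed

text \<open>
  An Appell series with theta argument \<open>q^e x^4\<close> and first argument \<open>-x^(-4) q^d\<close> has the denominators
  \<open>1 + q^(4(r-1)+e+d)\<close>, so \<open>e + d\<close> modulo \<open>4\<close> decides to which class of \<open>n\<close> it belongs. The classes of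
  \<open>0\<close> and \<open>2\<close> receive two series each, the odd classes one.
\<close>

lemma has_sum_upper_end:
  fixes J :: "nat \<Rightarrow> nat \<Rightarrow> complex"
  defines "J e d \<equiv> Theta (q ^ e * x ^ 4) (q ^ 4) *
    appell_m (- (x powi (-4)) * q ^ d) (q ^ e * x ^ 4) (q ^ 4)"
  assumes Th: "\<forall>e\<in>{0, 1, 3 :: nat}. Theta (q ^ e * x ^ 4) (q ^ 4) \<noteq> 0"
  shows "((\<lambda>n. x powi n * upper_end q n / (1 + q powi n)) has_sum
    (Theta_sub 6 12 q * (x powi (-3) * J 0 1 - x powi (-1) * J 0 3) -
     Theta_sub 3 12 q * (x powi (-2) * J 1 1 - J 1 3) +
     Theta_sub 3 12 q * (J 3 1 - x ^ 2 * J 3 3))) UNIV"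
    (is "(?f has_sum _) UNIV")
proof -
  let ?j = "\<lambda>e d r. signed_power q r (4 * choose2 r + int e * r) * x powi (4 * r) /
    (1 + q powi (4 * (r - 1) + int (e + d)))"
  let ?S = "\<lambda>j::nat. if j = 0 then Theta_sub 3 12 q * J 1 3 + Theta_sub 3 12 q * J 3 1
     else if j = 1 then - (Theta_sub 6 12 q * x powi (-1)) * J 0 3
     else if j = 2 then - (Theta_sub 3 12 q * x powi (-2)) * J 1 1 + - (Theta_sub 3 12 q * x ^ 2) * J 3 3
     else Theta_sub 6 12 q * x powi (-3) * J 0 1"
  have J: "(?j e d has_sum J e d) UNIV" if "e \<in> {0, 1, 3}" for e d
  proof -
    have "(-1) powi r * q powi (int 4 * choose2 r) * (q ^ e * x ^ 4) powi r =
        signed_power q r (4 * choose2 r + int e * r) * x powi (4 * r)" for r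
      using q0 by (simp add: signed_power_def power_int_mult_distrib power_int_mult power_int_add)
    moreover have "- (x powi (-4)) * q ^ d * (q ^ e * x ^ 4) = - (q powi int (e + d))"
      using x unfolding power_int_of_nat by (simp add: power_int_minus power_add)
    ultimately show ?thesis
      using has_sum_appell[OF q, of 4 "q ^ e * x ^ 4" "- (x powi (-4)) * q ^ d" "int (e + d)"] x q0 bspec[OF Th that]
      by (simp add: J_def)
  qed
  have "(?f has_sum (\<Sum>j<4. ?S j)) UNIV"
  proof (rule has_sum_residue_classes)
    fix j :: nat assume "j < 4"
    then consider "j = 0" | "j = 1" | "j = 2" | "j = 3" by linarith
    then show "((\<lambda>r. ?f (int 4 * r - int j)) has_sum ?S j) UNIV"
    proof cases
      case 1
      have "?f (4 * r) = Theta_sub 3 12 q * ?j 1 3 r + Theta_sub 3 12 q * ?j 3 1 r" for r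
        unfolding upper_end_4r by (simp add: algebra_simps add_divide_distrib)
      then show ?thesis
        using has_sum_add[OF has_sum_cmult_right[OF J[of 1 3], of "Theta_sub 3 12 q"]
            has_sum_cmult_right[OF J[of 3 1], of "Theta_sub 3 12 q"]] 1 by simp
    next
      case 2
      have "?f (4 * r - 1) = - (Theta_sub 6 12 q * x powi (-1)) * ?j 0 3 r" for r
        unfolding upper_end_4r_minus_1 using x
            by (simp add: power_int_diff power_int_minus divide_inverse mult_ac)
      then show ?thesis
        using has_sum_cmult_right[OF J, of 0 "- (Theta_sub 6 12 q * x powi (-1))" 3] one_plus_powi_nonzero[OF q] 2 by simp
    next
      case 3
      have "?f (4 * r - 2) = - (Theta_sub 3 12 q * x powi (-2)) * ?j 1 1 r +
          - (Theta_sub 3 12 q * x ^ 2) * ?j 3 3 (r + (- 1))" for r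
      proof -
        have "x powi (4 * r - 2) = x ^ 2 * x powi (4 * (r + (- 1)))"
          "x powi (4 * r - 2) = x powi (- 2) * x powi (4 * r)"
          using power_int_add[of x 2 "4 * (r + (- 1))"] power_int_add[of x "- 2" "4 * r"] x
          by (simp_all add: algebra_simps)
        moreover have "4 * (r - 1) + int (1 + 1) = 4 * r - 2" "4 * (r + - 1 - 1) + int (3 + 3) = 4 * r - 2"
          by simp_all
        ultimately show ?thesis
          unfolding upper_end_4r_minus_2
          by (simp only: diff_conv_add_uminus distrib_left add_divide_distrib) (simp add: mult_ac)
      qed
      moreover have "((\<lambda>r. - (Theta_sub 3 12 q * x powi (-2)) * ?j 1 1 r +
          - (Theta_sub 3 12 q * x ^ 2) * ?j 3 3 (r + (- 1))) has_sum ?S 2) UNIV"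
        using has_sum_add[OF has_sum_cmult_right[OF J[of 1 1], of "- (Theta_sub 3 12 q * x powi (-2))"]
            has_sum_cmult_right[OF has_sum_shift_int[where a = "- 1", THEN iffD2, OF J[of 3 3]],
              of "- (Theta_sub 3 12 q * x ^ 2)"]] by simp
      ultimately show ?thesis using 3 by simp
    next
      case 4
      have "?f (4 * r - 3) = Theta_sub 6 12 q * x powi (-3) * ?j 0 1 r" for r
        unfolding upper_end_4r_minus_3 using x
            by (simp add: power_int_diff power_int_minus divide_inverse mult_ac)
      then show ?thesis
        using has_sum_cmult_right[OF J, of 0 "Theta_sub 6 12 q * x powi (-3)" 1] one_plus_powi_nonzero[OF q] 4 by simp
    qed
  qed simp
  moreover have "(\<Sum>j<4. ?S j) = Theta_sub 6 12 q * (x powi (-3) * J 0 1 - x powi (-1) * J 0 3) -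
     Theta_sub 3 12 q * (x powi (-2) * J 1 1 - J 1 3) +
     Theta_sub 3 12 q * (J 3 1 - x ^ 2 * J 3 3)"
    by (simp add: eval_nat_numeral lessThan_Suc) (simp add: algebra_simps)
  ultimately show ?thesis by metis
qed

end

end

theorem proposition8p1:
  fixes q x :: complex
  assumes "0 < norm q" and "norm q < 1"
    and "x \<noteq> 0"
    and "\<forall>k::int. - (x ^ 3) \<noteq> (q ^ 3) powi k"
    and "\<forall>k::int. x ^ 4 \<noteq> (q ^ 4) powi k"
    and "\<forall>k::int. q * x ^ 4 \<noteq> (q ^ 4) powi k"
    and "\<forall>k::int. q ^ 3 * x ^ 4 \<noteq> (q ^ 4) powi k"
  shows "hecke_f 1 2 3 (x powi (-1) * q ^ 2) (q ^ 3) q =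
      x powi (-1) * appell_m (x powi (-3) * q ^ 2) (- (x ^ 3)) (q ^ 3) * qpoch_inf q q
    + x powi (-2) * appell_m (x powi (-3) * q) (- (x ^ 3)) (q ^ 3) * qpoch_inf q q
    + x powi (-1) * (Theta_sub 6 12 q * Theta (x ^ 4) (q ^ 4) / Theta (- (x ^ 3)) (q ^ 3))
        * (x powi (-2) * appell_m (- (x powi (-4)) * q) (x ^ 4) (q ^ 4)
           - appell_m (- (x powi (-4)) * q ^ 3) (x ^ 4) (q ^ 4))
    - Theta_sub 3 12 q * Theta (q * x ^ 4) (q ^ 4) / Theta (- (x ^ 3)) (q ^ 3)
        * (x powi (-2) * appell_m (- (x powi (-4)) * q) (q * x ^ 4) (q ^ 4)
           - appell_m (- (x powi (-4)) * q ^ 3) (q * x ^ 4) (q ^ 4))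
    - q ^ 3 * x ^ 2 * (Theta_sub (-3) 12 q * Theta (q ^ 3 * x ^ 4) (q ^ 4) / Theta (- (x ^ 3)) (q ^ 3))
        * (x powi (-2) * appell_m (- (x powi (-4)) * q) (q ^ 3 * x ^ 4) (q ^ 4)
           - appell_m (- (x powi (-4)) * q ^ 3) (q ^ 3 * x ^ 4) (q ^ 4))"
proof -
  note q = assms(1,2) and x = assms(3)
  define T where "T = Theta (- (x ^ 3)) (q ^ 3)"
  have qm: "0 < norm (q ^ m)" "norm (q ^ m) < 1" if "m > 0" for m
    using q that by (auto simp: norm_power power_less_one_iff)
  have T0: "T \<noteq> 0"
    unfolding T_def by (rule Theta_nonzero[OF qm]) (use assms in auto)
  have Th4: "\<forall>e\<in>{0, 1, 3 :: nat}. Theta (q ^ e * x ^ 4) (q ^ 4) \<noteq> 0"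
    by (intro ballI Theta_nonzero[OF qm]) (use assms in auto)
  note lower = has_sum_lower_end[OF q x T0[unfolded T_def], folded T_def]
  note upper = has_sum_upper_end[OF q x Th4]
  have "((\<lambda>n. x powi n * lower_end q n / (1 + q powi n) + x powi n * upper_end q n / (1 + q powi n)) has_sum
     (T * hecke_f 1 2 3 (x powi (-1) * q ^ 2) (q ^ 3) q)) UNIV"
    using has_sum_Theta_times_hecke[OF q x] by (simp only: T_def distrib_left add_divide_distrib)
  \<comment> \<open>Both sides of the theorem, multiplied by \<open>T\<close>, are sums of the same Laurent series.\<close>
  note eq = has_sum_unique[OF this has_sum_add[OF lower upper]]
  have Tm3: "Theta_sub (-3) 12 q = - Theta_sub 3 12 q / q ^ 3"
    using Theta_sub_minus_3_12[OF q] q by (simp add: field_simps)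
  have quotient: "h = R / T" if "T * h = R" for h R
    using that T0 by auto
  show ?thesis
    unfolding quotient[OF eq] Tm3 T_def[symmetric] using T0 x q
    by (simp add: power_int_minus field_simps) (simp flip: power_Suc)
qed

end
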